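(* Let $(X,d)$ be a compact metric space and let $\{\xi_n\}_{n\ge1}$ be an exponentially mixing stationary process on a probability space $(\Omega,\mathscr{A},\mathbb{P})$ taking values in $X$, with distribution $\mu$ (that is, $\mu(A)=\mathbb{P}(\xi_1\in A)$ for all Borel sets $A\subset X$). Assume that $\mu$ is Ahlfors $s$-regular with $0<s<\infty$. Let $\{\ell_n\}_{n\ge1}$ be a sequence of positive numbers decreasing to zero whose upper Besicovitch-Taylor index $\alpha$ satisfies $\alpha<s$, and let $E=\limsup_{n\to\infty}B(\xi_n,\ell_n)=\{y\in X: y\in B(\xi_n,\ell_n)\text{ for infinitely many }n\}$. Then for every analytic set $G\subset X$: (i) $\mathbb{P}(E\cap G\neq\varnothing)=0$ if $\dim_{\rm P}(G)<s-\alpha$; (ii) $\mathbb{P}(E\cap G\neq\varnothing)=1$ if $\dim_{\rm H}(G)>s-\alpha$.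
   Context: $B(x,r)$ denotes the closed ball with center $x$ and radius $r$. A stationary process $\{\xi_n\}_{n\ge1}$ is exponentially mixing if there are constants $C>0$ and $0<\rho<1$ such that $|\mathbb{P}(\xi_1\in A\mid D)-\mathbb{P}(\xi_1\in A)|\le C\rho^n$ for all $n\ge1$, all balls $A\subset X$ and all $D\in\mathscr{A}^{n+1}$ (with $\mathbb{P}(D)>0$), where $\mathscr{A}^{n+1}$ is the sub-$\sigma$-field generated by $\{\xi_{n+i}\}_{i\ge1}$. $\mu$ is Ahlfors $s$-regular if there is a constant $1\le c_1<\infty$ with $c_1^{-1}r^s\le\mu(B(x,r))\le c_1r^s$ for all $x\in X$ and $0<r\le\operatorname{diam}X$. The upper Besicovitch-Taylor index of $\{\ell_n\}$ is $\alpha=\inf\{t\le s:\sum_{n=1}^\infty\ell_n^t<\infty\}=\sup\{t\le s:\sum_{n=1}^\infty\ell_n^t=\infty\}$. $\dim_{\rm H}$ and $\dim_{\rm P}$ denote Hausdorff and packing dimension in $(X,d)$; by convention both equal $-\infty$ for the empty set.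
   Formalization: The space X is assumed to have at least two points; for a one-point X the Ahlfors condition over 0 < r ≤ diam X is vacuous and (i) fails with G = X. *)

theory Defs
  imports "HOL-Probability.Probability"
begin

subsection \<open>Hausdorff and packing dimension\<close>

text \<open>The case distinctions implement \<open>(diam \<emptyset>)^t = 0\<close> and \<open>0^0 = 1\<close>, whereas \<open>0 powr 0 = 0\<close>
  in the library.\<close>

definition diam_pow :: "real \<Rightarrow> 'a::metric_space set \<Rightarrow> ennreal" where
  "diam_pow t U = (if U = {} then 0 else if t = 0 then 1 else ennreal (diameter U powr t))"

text \<open>Boundedness is required explicitly because the library sets the diameter of an unbounded
  set to 0.\<close>

definition hausdorff_premeasure :: "real \<Rightarrow> real \<Rightarrow> 'a::metric_space set \<Rightarrow> ennreal" where
  "hausdorff_premeasure t \<delta> A =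
     (INF U \<in> {U :: nat \<Rightarrow> 'a set.
                 A \<subseteq> (\<Union>i. U i) \<and> (\<forall>i. bounded (U i) \<and> diameter (U i) \<le> \<delta>)}.
        \<Sum>i. diam_pow t (U i))"

definition hausdorff_measure :: "real \<Rightarrow> 'a::metric_space set \<Rightarrow> ennreal" where
  "hausdorff_measure t A = (SUP \<delta> \<in> {0<..}. hausdorff_premeasure t \<delta> A)"

definition hausdorff_dim :: "'a::metric_space set \<Rightarrow> ereal" where
  "hausdorff_dim A =
     (if A = {} then -\<infinity> else Inf {ereal t | t. 0 \<le> t \<and> hausdorff_measure t A = 0})"

text \<open>A packing of \<open>A\<close> is a family of pairwise disjoint closed balls centred in \<open>A\<close>, recorded as
  pairs (centre, radius), since in a metric space a ball need not determine its centre and radius.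
  Suprema over finite and over countable packings coincide.\<close>

definition packings :: "real \<Rightarrow> 'a::metric_space set \<Rightarrow> ('a \<times> real) set set" where
  "packings \<delta> A =
     {F. finite F \<and> F \<subseteq> A \<times> {0<..\<delta>} \<and> disjoint_family_on (\<lambda>(x, r). cball x r) F}"

definition packing_premeasure :: "real \<Rightarrow> 'a::metric_space set \<Rightarrow> ennreal" where
  "packing_premeasure t A =
     (INF \<delta> \<in> {0<..}. SUP F \<in> packings \<delta> A. \<Sum>(x, r)\<in>F. ennreal ((2 * r) powr t))"

definition packing_measure :: "real \<Rightarrow> 'a::metric_space set \<Rightarrow> ennreal" where
  "packing_measure t A =
     (INF U \<in> {U :: nat \<Rightarrow> 'a set. A \<subseteq> (\<Union>i. U i)}. \<Sum>i. packing_premeasure t (U i))"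

definition packing_dim :: "'a::metric_space set \<Rightarrow> ereal" where
  "packing_dim A =
     (if A = {} then -\<infinity> else Inf {ereal t | t. 0 \<le> t \<and> packing_measure t A = 0})"


subsection \<open>Analytic sets\<close>

text \<open>Here \<open>nat \<Rightarrow> nat\<close> carries the product topology, so it is the Baire space. The definition is
  intended for subsets of Polish spaces.\<close>

definition analytic_set :: "'a::topological_space set \<Rightarrow> bool" where
  "analytic_set A \<longleftrightarrow>
     A = {} \<or> (\<exists>f :: (nat \<Rightarrow> nat) \<Rightarrow> 'a. continuous_on UNIV f \<and> range f = A)"


subsection \<open>Ahlfors regularity\<close>

text \<open>On a one-point space the range of radii is empty and the condition is vacuous; such spaces have
  to be excluded separately.\<close>

definition ahlfors_regular :: "real \<Rightarrow> 'a::metric_space measure \<Rightarrow> bool" where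
  "ahlfors_regular s \<mu> \<longleftrightarrow>
     (\<exists>c\<ge>1. \<forall>x r. 0 < r \<and> r \<le> diameter (UNIV :: 'a set) \<longrightarrow>
        r powr s / c \<le> measure \<mu> (cball x r) \<and> measure \<mu> (cball x r) \<le> c * r powr s)"


subsection \<open>Stationary and exponentially mixing processes\<close>

text \<open>Processes are indexed by the positive integers; the variable with index 0 is ignored.\<close>

definition stationary_process :: "'w measure \<Rightarrow> (nat \<Rightarrow> 'w \<Rightarrow> 'a::topological_space) \<Rightarrow> bool" where
  "stationary_process M \<xi> \<longleftrightarrow>
     (\<forall>n\<ge>1. \<xi> n \<in> measurable M borel) \<and>
     (\<forall>m. distr M (\<Pi>\<^sub>M n\<in>{1..}. borel) (\<lambda>\<omega>. \<lambda>n\<in>{1..}. \<xi> (n + m) \<omega>) =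
          distr M (\<Pi>\<^sub>M n\<in>{1..}. borel) (\<lambda>\<omega>. \<lambda>n\<in>{1..}. \<xi> n \<omega>))"

definition future_events ::
  "'w measure \<Rightarrow> (nat \<Rightarrow> 'w \<Rightarrow> 'a::topological_space) \<Rightarrow> nat \<Rightarrow> 'w set set" where
  "future_events M \<xi> k =
     sigma_sets (space M) {\<xi> n -` S \<inter> space M | n S. n \<ge> k \<and> S \<in> sets borel}"

definition exponentially_mixing ::
  "'w measure \<Rightarrow> (nat \<Rightarrow> 'w \<Rightarrow> 'a::metric_space) \<Rightarrow> bool" where
  "exponentially_mixing M \<xi> \<longleftrightarrow>
     (\<exists>C>0. \<exists>\<rho>. 0 < \<rho> \<and> \<rho> < 1 \<and>
        (\<forall>n\<ge>1. \<forall>x. \<forall>r>0. \<forall>D\<in>future_events M \<xi> (n + 1). measure M D > 0 \<longrightarrow>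
           \<bar>\<P>(\<omega> in M. \<xi> 1 \<omega> \<in> cball x r \<bar> \<omega> \<in> D) - \<P>(\<omega> in M. \<xi> 1 \<omega> \<in> cball x r)\<bar>
             \<le> C * \<rho> ^ n))"


subsection \<open>The upper Besicovitch--Taylor index\<close>

text \<open>The supremum is used because it makes sense for every sequence decreasing to zero: its set
  is nonempty (it contains 0) and bounded by \<open>s\<close>. The lemma below shows that it agrees with the
  infimum whenever the latter is over a nonempty set; otherwise the value is \<open>s\<close>.\<close>

definition upper_BT_index :: "real \<Rightarrow> (nat \<Rightarrow> real) \<Rightarrow> real" where
  "upper_BT_index s l = Sup {t. t \<le> s \<and> \<not> summable (\<lambda>n. l (Suc n) powr t)}"

lemma upper_BT_index_eq_Inf:
  fixes s :: real and l :: "nat \<Rightarrow> real"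
  assumes s: "0 < s"
    and pos: "\<And>n. n \<ge> 1 \<Longrightarrow> 0 < l n"
    and lim: "l \<longlonglongrightarrow> 0"
    and ne: "\<exists>t\<le>s. summable (\<lambda>n. l (Suc n) powr t)"
  shows "upper_BT_index s l = Inf {t. t \<le> s \<and> summable (\<lambda>n. l (Suc n) powr t)}"
proof -
  define P where "P t \<longleftrightarrow> summable (\<lambda>n. l (Suc n) powr t)" for t
  have lim': "(\<lambda>n. l (Suc n)) \<longlonglongrightarrow> 0"
    using lim by (rule LIMSEQ_Suc)
  have mono: "P v" if "P u" "u \<le> v" for u v
    unfolding P_def
  proof (rule summable_comparison_test_ev)
    have "eventually (\<lambda>n. l (Suc n) < 1) sequentially"
      using order_tendstoD(2)[OF lim'] by simp
    then show "eventually (\<lambda>n. norm (l (Suc n) powr v) \<le> l (Suc n) powr u) sequentially"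
    proof eventually_elim
      case (elim n)
      have "0 < l (Suc n)" by (rule pos) simp
      with elim that(2) show ?case
        by (simp add: powr_mono')
    qed
    show "summable (\<lambda>n. l (Suc n) powr u)" using that(1) by (simp add: P_def)
  qed
  have "l (Suc n) \<noteq> 0" for n
    using pos[of "Suc n"] by simp
  then have "\<not> P 0"
    by (simp add: P_def summable_const_iff)
  have lt: "d < c" if "\<not> P d" "P c" for c d
    using mono[OF that(2), of d] that(1) by linarith
  let ?D = "{t. t \<le> s \<and> \<not> P t}" and ?C = "{t. t \<le> s \<and> P t}"
  have D0: "0 \<in> ?D" using s \<open>\<not> P 0\<close> by simp
  obtain c where c: "c \<in> ?C" using ne by (auto simp: P_def)
  have bd: "bdd_above ?D" by (auto intro: bdd_aboveI)
  have bc: "bdd_below ?C" using lt[OF \<open>\<not> P 0\<close>] by (auto intro!: bdd_belowI[of _ 0] less_imp_le)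
  have "Sup ?D \<le> Inf ?C"
    using D0 c lt by (intro cSup_least cInf_greatest) (auto intro: less_imp_le)
  moreover have "\<not> Sup ?D < Inf ?C"
  proof
    assume "Sup ?D < Inf ?C"
    then obtain m where m: "Sup ?D < m" "m < Inf ?C" using dense by blast
    have "m \<le> s" using m(2) cInf_lower[OF c bc] c by simp
    then have "m \<in> ?D \<or> m \<in> ?C" by auto
    then show False
      using m cSup_upper[OF _ bd] cInf_lower[OF _ bc] by fastforce
  qed
  ultimately show ?thesis
    by (simp add: upper_BT_index_def P_def)
qed


subsection \<open>Random covering sets\<close>

definition limsup_balls :: "(nat \<Rightarrow> 'w \<Rightarrow> 'a::metric_space) \<Rightarrow> (nat \<Rightarrow> real) \<Rightarrow> 'w \<Rightarrow> 'a set" where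
  "limsup_balls \<xi> l \<omega> = {y. \<exists>\<^sub>\<infinity>n. y \<in> cball (\<xi> n \<omega>) (l n)}"

text \<open>For analytic \<open>G\<close> this set is in general measurable only with respect to the completion of
  the underlying probability measure.\<close>

definition hitting_event ::
  "'w measure \<Rightarrow> (nat \<Rightarrow> 'w \<Rightarrow> 'a::metric_space) \<Rightarrow> (nat \<Rightarrow> real) \<Rightarrow> 'a set \<Rightarrow> 'w set" where
  "hitting_event M \<xi> l G = {\<omega> \<in> space M. limsup_balls \<xi> l \<omega> \<inter> G \<noteq> {}}"

end

theory Submission
  imports Defs "HOL-Real_Asymp.Real_Asymp"
begin

text \<open>Both statements compare, at a scale \<open>r\<close>, the number of balls of radius \<open>r\<close>
  needed for a set with the probability \<open>r\<^sup>s\<close> (up to constants) that a given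
  \<open>\<xi>\<^sub>n\<close> falls into one such ball.

  If the packing dimension of \<open>G\<close> is below \<open>s - \<alpha>\<close>, then for some \<open>t < s -
  \<alpha>\<close> the set \<open>G\<close> is covered by countably many pieces with finite packing premeasure of
  order \<open>t\<close>. Such a piece is covered by \<open>O(r powr - t)\<close> balls of radius \<open>2 r\<close>,
  so the \<open>n\<close>-th ball meets it with probability \<open>O(l\<^sub>n powr (s - t))\<close>. This is summable
  because \<open>s - t > \<alpha>\<close>, and the Borel--Cantelli lemma applies
  (\<open>AE_not_hit_of_finite_packing_premeasure\<close>).

  For the other half fix \<open>t\<close> strictly between \<open>s - \<alpha>\<close> and the Hausdorff dimension of
  \<open>G\<close>, so that \<open>G\<close> has positive Hausdorff measure of order \<open>t\<close>. The heart of
  the proof is \<open>AE_hits_infinitely_often\<close>: every set \<open>A\<close> of positive Hausdorff measure of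
  order \<open>t\<close> is almost surely met by infinitely many of the random open balls. One scale is used at a
  time: at a small scale \<open>r\<close> the set \<open>A\<close> contains the centres of at least \<open>c r powr -
  t\<close> disjoint balls of radius \<open>r\<close>, and a given \<open>\<xi>\<^sub>n\<close> falls into their union
  \<open>U\<close> with probability at least of order \<open>r powr (s - t)\<close>. By definition of the index,
  infinitely many \<open>n\<close> satisfy \<open>n \<ge> l\<^sub>n powr - \<beta>\<close> with \<open>\<beta> <
  \<alpha>\<close> and \<open>t + \<beta> > s\<close>. Take \<open>r\<close> to be half of \<open>l\<^sub>n\<close>;
  as the radii decrease, each of the first \<open>n\<close> balls whose centre lies in \<open>U\<close> meets
  \<open>A\<close>. Along indices with gaps of about \<open>r powr - \<epsilon>\<close>, mixing makes the trials
  nearly independent (\<open>prob_miss_le\<close>): the mixing error for each of the balls forming \<open>U\<close> is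
  at most half of the lower bound for its probability. The chance that the trials with index between a fixed
  \<open>m\<close> and \<open>n\<close> all fail is thus at most \<open>exp (- \<kappa> r powr - \<epsilon>)\<close>,
  which tends to 0 along these \<open>n\<close>.

  To pass from infinitely many balls meeting a set to one point in infinitely many balls, write \<open>G\<close> as
  the image of the Baire space under a continuous \<open>f\<close> and let \<open>K\<close> consist of the sequences
  all of whose cylinders have an image of positive measure. Every cylinder around a point of \<open>K\<close> still
  has an image of positive measure after intersection with \<open>K\<close>, so almost surely all these countably many
  images are hit infinitely often, and a Baire category construction in \<open>K\<close> finishes the proof
  (\<open>Baire_space_meets_limsup\<close>).\<close>

section \<open>Disjoint balls and Hausdorff null sets\<close>

text \<open>Two disjoint balls of radius \<open>r\<close> have centres more than \<open>r\<close> apart, so total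
  boundedness limits the number of balls in a packing, and a packing with the largest number exists. A point outside
  all the doubled balls could be added to it.\<close>

lemma maximal_packing:
  fixes A :: "'a::metric_space set" and r :: real
  assumes cpt: "compact (UNIV :: 'a set)" and r: "0 < r"
  obtains P where "finite P" "P \<subseteq> A" "disjoint_family_on (\<lambda>p. cball p r) P"
    "A \<subseteq> (\<Union>p\<in>P. cball p (2 * r))"
proof -
  define good where
    "good P \<longleftrightarrow> finite P \<and> P \<subseteq> A \<and> disjoint_family_on (\<lambda>p. cball p r) P" for P
  obtain k where k: "finite k" "(UNIV :: 'a set) \<subseteq> (\<Union>x\<in>k. ball x (r / 2))"
    using cpt half_gt_zero[OF r] unfolding compact_eq_totally_bounded by blast
  have bound: "card P \<le> card k" if "good P" for P
  proof -
    have "\<forall>p. \<exists>x\<in>k. p \<in> ball x (r / 2)" using k(2) by blast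
    then obtain h where h: "\<And>p. h p \<in> k" "\<And>p. p \<in> ball (h p) (r / 2)" by metis
    have "inj_on h P"
    proof (rule inj_onI, rule ccontr)
      fix p q assume pq: "p \<in> P" "q \<in> P" "h p = h q" "p \<noteq> q"
      have "dist (h p) p < r / 2" "dist (h p) q < r / 2"
        using h(2)[of p] h(2)[of q] unfolding pq(3) mem_ball .
      then have "dist p q < r" by (rule dist_triangle_half_r)
      then have "q \<in> cball p r \<inter> cball q r" using r by simp
      moreover have "cball p r \<inter> cball q r = {}"
        using that pq unfolding good_def disjoint_family_on_def by blast
      ultimately show False by blast
    qed
    then show ?thesis using h(1) k(1) by (meson card_inj_on_le image_subsetI)
  qed
  have "good {}" by (simp add: good_def disjoint_family_on_def)
  then have "\<exists>P. good P \<and> (\<forall>Q. good Q \<longrightarrow> card Q \<le> card P)"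
    by (rule ex_has_greatest_nat[where b = "Suc (card k)"]) (simp add: bound less_Suc_eq_le)
  then obtain P where P: "good P" "\<And>Q. good Q \<Longrightarrow> card Q \<le> card P" by blast
  have "A \<subseteq> (\<Union>p\<in>P. cball p (2 * r))"
  proof (rule ccontr)
    assume "\<not> ?thesis"
    then obtain a where a: "a \<in> A" "\<forall>p\<in>P. \<not> dist p a \<le> 2 * r"
      by (auto simp: subset_iff)
    have "a \<notin> P" using a(2) r by auto
    have dj: "cball p r \<inter> cball a r = {}" if "p \<in> P" for p
    proof -
      have False if "x \<in> cball p r" "x \<in> cball a r" for x
        using that a(2) \<open>p \<in> P\<close> dist_triangle2[of p a x] by fastforce
      then show ?thesis by blast
    qed
    have "good (insert a P)"
      using P(1) a(1) dj \<open>a \<notin> P\<close> unfolding good_def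
      by (auto simp: disjoint_family_on_insert)
    from P(2)[OF this] \<open>a \<notin> P\<close> P(1) show False by (simp add: good_def)
  qed
  with P(1) show ?thesis by (intro that[of P]) (simp_all add: good_def)
qed

lemma hausdorff_null_iff:
  "hausdorff_measure t A = 0 \<longleftrightarrow> (\<forall>\<delta>>0. hausdorff_premeasure t \<delta> A = 0)"
  by (auto simp: hausdorff_measure_def simp flip: bot_ennreal)

lemma hausdorff_measure_empty: "hausdorff_measure t ({} :: 'a::metric_space set) = 0"
  unfolding hausdorff_null_iff
proof (intro allI impI)
  fix \<delta> :: real assume "0 < \<delta>"
  then have "hausdorff_premeasure t \<delta> ({} :: 'a set) \<le> (\<Sum>i::nat. diam_pow t ({} :: 'a set))"
    unfolding hausdorff_premeasure_def by (intro INF_lower) auto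
  then show "hausdorff_premeasure t \<delta> ({} :: 'a set) = 0" by (simp add: diam_pow_def)
qed

lemma hausdorff_premeasure_null_UN:
  assumes sub: "B \<subseteq> (\<Union>i::nat. A i)" and null: "\<And>i. hausdorff_premeasure t \<delta> (A i) = 0"
  shows "hausdorff_premeasure t \<delta> B = 0"
proof -
  have "hausdorff_premeasure t \<delta> B \<le> 0 + ennreal e" if "0 < e" for e
  proof -
    have "\<exists>U. A i \<subseteq> (\<Union>j. U j) \<and> (\<forall>j. bounded (U j) \<and> diameter (U j) \<le> \<delta>) \<and>
        (\<Sum>j. diam_pow t (U j)) < ennreal (e * (1/2) ^ Suc i)" for i
    proof -
      have "hausdorff_premeasure t \<delta> (A i) < ennreal (e * (1/2) ^ Suc i)"
        using null[of i] \<open>0 < e\<close> by simp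
      then show ?thesis unfolding hausdorff_premeasure_def INF_less_iff by auto
    qed
    then obtain U where U: "\<And>i. A i \<subseteq> (\<Union>j::nat. U i j)"
        "\<And>i j. bounded (U i j)" "\<And>i j. diameter (U i j) \<le> \<delta>"
        "\<And>i. (\<Sum>j. diam_pow t (U i j)) < ennreal (e * (1/2) ^ Suc i)"
      by metis
    define V where "V n = case_prod U (prod_decode n)" for n
    have "B \<subseteq> (\<Union>n. V n)"
    proof
      fix b assume "b \<in> B"
      then obtain i j where "b \<in> U i j" using sub U(1) by blast
      then have "b \<in> V (prod_encode (i, j))" by (simp add: V_def)
      then show "b \<in> (\<Union>n. V n)" by blast
    qed
    then have "hausdorff_premeasure t \<delta> B \<le> (\<Sum>n. diam_pow t (V n))"
      unfolding hausdorff_premeasure_def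
      by (intro INF_lower) (auto simp: V_def U split: prod.split)
    also have "\<dots> = (\<Sum>i. \<Sum>j. diam_pow t (U i j))"
      using suminf_ennreal_2dimen[of "\<lambda>i. \<Sum>j. diam_pow t (U i j)"
          "\<lambda>p. diam_pow t (case_prod U p)"]
      by (simp add: V_def)
    also have "\<dots> \<le> (\<Sum>i. ennreal (e * (1/2) ^ Suc i))"
      using U(4) by (intro suminf_le) (auto intro: less_imp_le)
    also have "\<dots> = ennreal e"
    proof (rule suminf_ennreal_eq)
      show "(\<lambda>i. e * (1/2) ^ Suc i) sums e"
        using sums_mult[OF power_half_series, of e] by simp
    qed (use \<open>0 < e\<close> in simp)
    finally show ?thesis by simp
  qed
  then show ?thesis using ennreal_le_epsilon[of 0 "hausdorff_premeasure t \<delta> B"] by simp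
qed

lemma hausdorff_null_UN:
  assumes "B \<subseteq> (\<Union>i::nat. A i)" "\<And>i. hausdorff_measure t (A i) = 0"
  shows "hausdorff_measure t B = 0"
  using assms hausdorff_premeasure_null_UN[of B A] by (auto simp: hausdorff_null_iff)

lemma hausdorff_null_countable_Union:
  assumes "countable \<A>" "B \<subseteq> \<Union>\<A>" "\<And>A. A \<in> \<A> \<Longrightarrow> hausdorff_measure t A = 0"
  shows "hausdorff_measure t B = 0"
proof (cases "\<A> = {}")
  case True
  then show ?thesis using assms(2) by (simp add: hausdorff_measure_empty)
next
  case False
  show ?thesis
  proof (rule hausdorff_null_UN)
    show "B \<subseteq> (\<Union>i. from_nat_into \<A> i)"
      using assms(1,2) False by (simp add: range_from_nat_into)
    show "hausdorff_measure t (from_nat_into \<A> i) = 0" for i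
      using assms(3) False by (simp add: from_nat_into)
  qed
qed

text \<open>Doubling the balls of a maximal packing gives a cover by sets of diameter at most \<open>4 r\<close>,
  which cannot be too cheap when the premeasure at some fixed scale is positive. So positive Hausdorff measure bounds
  the packing numbers from below at all small scales, not just along a sequence of scales.\<close>

lemma large_packing_if_hausdorff_nonnull:
  fixes A :: "'a::metric_space set"
  assumes cpt: "compact (UNIV :: 'a set)" and t: "0 < t" and A: "hausdorff_measure t A \<noteq> 0"
  shows "\<exists>c>0. \<exists>r0>0. \<forall>r. 0 < r \<longrightarrow> r < r0 \<longrightarrow>
    (\<exists>P. finite P \<and> P \<subseteq> A \<and> disjoint_family_on (\<lambda>p. cball p r) P \<and>
         c * r powr - t \<le> real (card P))"
proof -
  obtain \<delta> where \<delta>: "0 < \<delta>" "hausdorff_premeasure t \<delta> A \<noteq> 0"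
    using A by (auto simp: hausdorff_null_iff)
  then obtain c where c: "0 < c" "ennreal c \<le> hausdorff_premeasure t \<delta> A"
    by (cases "hausdorff_premeasure t \<delta> A") (auto simp: less_le top_unique intro: zero_less_one)
  have "\<exists>P. finite P \<and> P \<subseteq> A \<and> disjoint_family_on (\<lambda>p. cball p r) P \<and>
         c * 4 powr - t * r powr - t \<le> real (card P)" if r: "0 < r" "r < \<delta> / 4" for r
  proof -
    obtain P where P: "finite P" "P \<subseteq> A" "disjoint_family_on (\<lambda>p. cball p r) P"
      "A \<subseteq> (\<Union>p\<in>P. cball p (2 * r))"
      using maximal_packing[OF cpt r(1)] by metis
    obtain h where h: "bij_betw h {0..<card P} P" using ex_bij_betw_nat_finite[OF P(1)] by blast
    \<comment> \<open>The definition of the premeasure asks for an infinite sequence; empty sets cost nothing.\<close>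
    define U where "U i = (if i < card P then cball (h i) (2 * r) else {})" for i :: nat
    have diam: "diameter (U i) \<le> 4 * r" for i
    proof (cases "U i = {}")
      case False
      have "dist x y \<le> 4 * r" if "x \<in> U i" "y \<in> U i" for x y
        using that dist_triangle3[of x y "h i"] by (auto simp: U_def split: if_splits)
      with False show ?thesis unfolding diameter_def by (auto intro!: cSUP_least)
    qed (use r in simp)
    have "A \<subseteq> (\<Union>i. U i)"
    proof
      fix a assume "a \<in> A"
      then obtain p where p: "p \<in> P" "a \<in> cball p (2 * r)" using P(4) by blast
      moreover have "p \<in> h ` {0..<card P}" using p h by (simp add: bij_betw_def)
      ultimately obtain i where "i < card P" "h i = p" by auto
      with p show "a \<in> (\<Union>i. U i)" by (auto simp: U_def intro!: exI[of _ i])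
    qed
    moreover have "bounded (U i)" "diameter (U i) \<le> \<delta>" for i
      using diam[of i] r by (auto simp: U_def)
    ultimately have "hausdorff_premeasure t \<delta> A \<le> (\<Sum>i. diam_pow t (U i))"
      unfolding hausdorff_premeasure_def by (intro INF_lower) auto
    also have "\<dots> = (\<Sum>i<card P. diam_pow t (U i))"
      by (rule suminf_finite) (auto simp: U_def diam_pow_def)
    also have "\<dots> \<le> (\<Sum>i<card P. ennreal ((4 * r) powr t))"
    proof (rule sum_mono)
      fix i
      have "diameter (U i) powr t \<le> (4 * r) powr t"
        using diam[of i] t by (intro powr_mono2) (auto intro: diameter_ge_0 simp: U_def)
      then show "diam_pow t (U i) \<le> ennreal ((4 * r) powr t)"
        using t by (auto simp: diam_pow_def intro: ennreal_leI)
    qed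
    also have "\<dots> = ennreal (real (card P) * (4 * r) powr t)"
      by (simp add: ennreal_mult ennreal_of_nat_eq_real_of_nat)
    finally have "c \<le> real (card P) * (4 * r) powr t"
      using c order_trans by (fastforce simp: ennreal_le_iff)
    then have "c * 4 powr - t * r powr - t \<le> real (card P)"
      using r by (simp add: powr_minus powr_mult field_simps)
    with P show ?thesis by blast
  qed
  moreover have "0 < c * 4 powr - t" "0 < \<delta> / 4" using c \<delta> by auto
  ultimately show ?thesis by blast
qed

section \<open>Avoiding a union of balls along spaced times\<close>

lemma stationary_process_shift:
  assumes st: "stationary_process M \<xi>" and I: "finite I" "\<And>i. i \<in> I \<Longrightarrow> 1 \<le> i"
    and S: "S \<in> sets borel"
  shows "measure M {\<omega> \<in> space M. \<forall>i\<in>I. \<xi> (i + m) \<omega> \<in> S} =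
         measure M {\<omega> \<in> space M. \<forall>i\<in>I. \<xi> i \<omega> \<in> S}"
proof -
  let ?N = "(\<Pi>\<^sub>M n\<in>{1::nat..}. borel)"
  define Z where "Z = {x \<in> space ?N. \<forall>i\<in>I. x i \<in> S}"
  have meas: "\<xi> n \<in> measurable M borel" if "1 \<le> n" for n
    using st that by (simp add: stationary_process_def)
  have Z: "Z \<in> sets ?N"
  proof -
    have "{x \<in> space ?N. x i \<in> S} \<in> sets ?N" if "i \<in> I" for i
    proof -
      have "(\<lambda>x. x i) \<in> measurable ?N borel"
        using I(2)[OF that] by (intro measurable_component_singleton) auto
      then have "(\<lambda>x. x i) -` S \<inter> space ?N \<in> sets ?N" by (rule measurable_sets[OF _ S])
      also have "(\<lambda>x. x i) -` S \<inter> space ?N = {x \<in> space ?N. x i \<in> S}" by blast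
      finally show ?thesis .
    qed
    then show ?thesis unfolding Z_def using I(1) by (intro sets.sets_Collect_finite_All) auto
  qed
  have eq: "measure (distr M ?N (\<lambda>\<omega>. \<lambda>n\<in>{1..}. \<xi> (n + k) \<omega>)) Z =
        measure M {\<omega> \<in> space M. \<forall>i\<in>I. \<xi> (i + k) \<omega> \<in> S}" for k
  proof -
    have m: "(\<lambda>\<omega>. \<lambda>n\<in>{1..}. \<xi> (n + k) \<omega>) \<in> measurable M ?N"
      by (intro measurable_restrict meas) auto
    have "(\<lambda>\<omega>. \<lambda>n\<in>{1..}. \<xi> (n + k) \<omega>) -` Z \<inter> space M =
        {\<omega> \<in> space M. \<forall>i\<in>I. \<xi> (i + k) \<omega> \<in> S}"
      using I(2) measurable_space[OF m] by (auto simp: Z_def)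
    then show ?thesis using measure_distr[OF m Z] by simp
  qed
  show ?thesis using eq[of m] eq[of 0] st by (simp add: stationary_process_def)
qed

text \<open>Stationarity moves the first of the observed times to 1, and the others then give an event of the future
  from time \<open>g + 1\<close> on. Conditioning on it leaves a probability at least \<open>b\<close> of falling into
  each of the disjoint balls, so each additional time multiplies the probability of avoiding their union by at most
  \<open>1 - card P * b \<le> exp (- card P * b)\<close>.\<close>

lemma prob_miss_le:
  fixes \<xi> :: "nat \<Rightarrow> 'w \<Rightarrow> 'a::metric_space"
  assumes pr: "prob_space M" and st: "stationary_process M \<xi>"
    and mix: "\<And>D p. D \<in> future_events M \<xi> (g + 1) \<Longrightarrow> measure M D > 0 \<Longrightarrow> p \<in> P \<Longrightarrow>
        b \<le> \<P>(\<omega> in M. \<xi> 1 \<omega> \<in> cball p r \<bar> \<omega> \<in> D)"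
    and P: "finite P" "disjoint_family_on (\<lambda>p. cball p r) P" and g: "1 \<le> g" and m: "1 \<le> m"
  shows "measure M {\<omega> \<in> space M. \<forall>i<J. \<xi> (m + i * g) \<omega> \<notin> (\<Union>p\<in>P. cball p r)}
     \<le> exp (- (real J * (real (card P) * b)))"
proof -
  interpret prob_space M by (rule pr)
  define U where "U = (\<Union>p\<in>P. cball p r)"
  define miss where "miss I = {\<omega> \<in> space M. \<forall>i\<in>I. \<xi> i \<omega> \<in> - U}" for I
  have U: "- U \<in> sets borel" "U \<in> sets borel"
    using P(1) borel_closed[OF closed_UN[of P "\<lambda>p. cball p r"]]
    by (auto simp: U_def simp del: Compl_UN intro: borel_comp)
  have meas[measurable]: "\<xi> n \<in> measurable M borel" if "1 \<le> n" for n
    using st that by (simp add: stationary_process_def)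
  have shift: "prob (miss ((\<lambda>i. i + k) ` I)) = prob (miss I)"
    if "finite I" "\<And>i. i \<in> I \<Longrightarrow> 1 \<le> i" for I k
    using stationary_process_shift[OF st that U(1), of k] by (simp add: miss_def)
  have prim: "\<xi> i -` S \<inter> space M \<in> sets M" if "1 \<le> i" "S \<in> sets borel" for i S
    using meas[OF that(1)] that(2) by (rule measurable_sets)
  have preim: "\<xi> i -` S \<inter> space M = {\<omega> \<in> space M. \<xi> i \<omega> \<in> S}" for i S
    by blast
  define K where "K J = (\<lambda>i. 1 + i * g) ` {..<J}" for J :: nat
  have "prob (miss (K J)) \<le> exp (- (real J * (real (card P) * b)))" for J
  proof (induction J)
    case 0
    then show ?case by simp
  next
    case (Suc J)
    define D where "D = miss ((\<lambda>i. i + g) ` K J)"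
    have KS: "K (Suc J) = insert 1 ((\<lambda>i. i + g) ` K J)"
      by (auto simp: K_def lessThan_Suc_eq_insert_0 image_image algebra_simps)
    have D_fut: "D \<in> future_events M \<xi> (g + 1)"
    proof -
      let ?G = "{\<xi> n -` S \<inter> space M | n S. n \<ge> g + 1 \<and> S \<in> sets borel}"
      define F where "F = sigma (space M) ?G"
      have F: "sets F = sigma_sets (space M) ?G" "space F = space M"
        unfolding F_def by (subst sets_measure_of, auto simp: space_measure_of_conv)
      have "{\<omega> \<in> space F. \<forall>i\<in>(\<lambda>i. i + g) ` K J. \<xi> i \<omega> \<in> - U} \<in> sets F"
      proof (rule sets.sets_Collect_finite_All)
        fix i assume "i \<in> (\<lambda>i. i + g) ` K J"
        then have "g + 1 \<le> i" by (auto simp: K_def)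
        then have "\<xi> i -` (- U) \<inter> space M \<in> sets F"
          using U(1) unfolding F by (intro sigma_sets.Basic) blast
        then show "{\<omega> \<in> space F. \<xi> i \<omega> \<in> - U} \<in> sets F"
          by (simp only: F(2) preim)
      qed (simp add: K_def)
      then show ?thesis unfolding F by (simp add: D_def miss_def future_events_def)
    qed
    have D[measurable]: "D \<in> sets M"
    proof -
      have "{\<omega> \<in> space M. \<xi> i \<omega> \<in> - U} \<in> sets M" if "1 \<le> i" for i
        using prim[OF that U(1)] unfolding preim .
      then show ?thesis unfolding D_def miss_def
        by (intro sets.sets_Collect_finite_All) (auto simp: K_def)
    qed
    have "prob D = prob (miss (K J))"
      unfolding D_def by (rule shift) (auto simp: K_def)
    have "prob (miss (K (Suc J))) = prob (D - {\<omega> \<in> space M. \<xi> 1 \<omega> \<in> U})"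
      unfolding KS D_def miss_def by (rule arg_cong[where f = prob]) auto
    also have "\<dots> \<le> prob D * exp (- (real (card P) * b))"
    proof (cases "prob D = 0")
      case True
      then show ?thesis using finite_measure_mono[OF Diff_subset D] by simp
    next
      case False
      then have pos: "0 < prob D" by (simp add: zero_less_measure_iff)
      define H where "H p = {\<omega> \<in> space M. \<xi> 1 \<omega> \<in> cball p r \<and> \<omega> \<in> D}" for p
      have H: "H p \<in> sets M" for p
      proof -
        have "H p = (\<xi> 1 -` cball p r \<inter> space M) \<inter> D" by (auto simp: H_def)
        then show ?thesis using prim[of 1 "cball p r"] D by auto
      qed
      have DD: "{\<omega> \<in> space M. \<omega> \<in> D} = D" using sets.sets_into_space[OF D] by auto
      have "b * prob D \<le> prob (H p)" if "p \<in> P" for p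
        using mix[OF D_fut pos that] pos by (simp add: cond_prob_def H_def DD field_simps)
      then have "(\<Sum>p\<in>P. b * prob D) \<le> (\<Sum>p\<in>P. prob (H p))" by (rule sum_mono)
      also have "\<dots> = prob (\<Union>p\<in>P. H p)"
      proof (rule finite_measure_finite_Union[symmetric])
        have "H p \<inter> H q \<subseteq> \<xi> 1 -` (cball p r \<inter> cball q r)" for p q by (auto simp: H_def)
        then show "disjoint_family_on H P" using P(2) unfolding disjoint_family_on_def by blast
      qed (use P(1) H in auto)
      finally have "real (card P) * b * prob D \<le> prob (\<Union>p\<in>P. H p)" by simp
      moreover have "D - {\<omega> \<in> space M. \<xi> 1 \<omega> \<in> U} = D - (\<Union>p\<in>P. H p)"
        by (auto simp: H_def U_def)
      moreover have "prob (D - (\<Union>p\<in>P. H p)) = prob D - prob (\<Union>p\<in>P. H p)"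
        using H P(1) by (intro finite_measure_Diff D) (auto simp: H_def)
      ultimately have "prob (D - {\<omega> \<in> space M. \<xi> 1 \<omega> \<in> U}) \<le> prob D * (1 - real (card P) * b)"
        by (simp add: algebra_simps)
      also have "\<dots> \<le> prob D * exp (- (real (card P) * b))"
        using exp_ge_add_one_self[of "- (real (card P) * b)"] by (intro mult_left_mono) auto
      finally show ?thesis .
    qed
    also have "\<dots> \<le> exp (- (real J * (real (card P) * b))) * exp (- (real (card P) * b))"
      using Suc.IH \<open>prob D = prob (miss (K J))\<close> by (intro mult_right_mono) auto
    also have "\<dots> = exp (- (real (Suc J) * (real (card P) * b)))"
      by (simp add: algebra_simps flip: exp_add)
    finally show ?case .
  qed
  moreover have "{\<omega> \<in> space M. \<forall>i<J. \<xi> (m + i * g) \<omega> \<notin> (\<Union>p\<in>P. cball p r)} =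
      miss ((\<lambda>i. i + (m - 1)) ` K J)"
    unfolding U_def[symmetric] using m by (auto simp: miss_def K_def image_image add.commute[of m])
  moreover have "prob (miss ((\<lambda>i. i + (m - 1)) ` K J)) = prob (miss (K J))"
    by (rule shift) (auto simp: K_def)
  ultimately show ?thesis by metis
qed

section \<open>The Besicovitch--Taylor index and the scales it provides\<close>

text \<open>For positive \<open>\<beta>\<close>, if \<open>l n < n powr - (1 / \<beta>)\<close> held from some point
  on, then the series of \<open>l n powr u\<close> would converge for every \<open>u > \<beta>\<close>, although it
  diverges for some such \<open>u\<close>. Nonpositive \<open>\<beta>\<close> must be included because the index may
  be 0.\<close>

lemma infinitely_many_large_radii:
  fixes l :: "nat \<Rightarrow> real"
  assumes pos: "\<And>n. 1 \<le> n \<Longrightarrow> 0 < l n" and lim: "l \<longlonglongrightarrow> 0"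
    and s: "0 < s" and \<beta>: "\<beta> < upper_BT_index s l"
  shows "\<exists>\<^sub>\<infinity>n. 1 \<le> n \<and> 1 \<le> real n * l n powr \<beta>"
proof (rule ccontr)
  assume "\<not> ?thesis"
  then have "eventually (\<lambda>n. \<not> (1 \<le> n \<and> 1 \<le> real n * l n powr \<beta>)) sequentially"
    unfolding frequently_def cofinite_eq_sequentially by simp
  then have ev: "eventually (\<lambda>n. real n * l n powr \<beta> < 1) sequentially"
    using eventually_ge_at_top[of 1] by eventually_elim auto
  have lt1: "eventually (\<lambda>n. l n < 1) sequentially"
    using order_tendstoD(2)[OF lim] by simp
  show False
  proof (cases "\<beta> \<le> 0")
    case True
    have "eventually (\<lambda>n. False) sequentially"
      using ev lt1 eventually_ge_at_top[of 1]
    proof eventually_elim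
      case (elim n)
      have "1 \<le> l n powr \<beta>"
        using powr_mono'[of \<beta> 0 "l n"] True elim pos[of n] by simp
      then have "1 * 1 \<le> real n * l n powr \<beta>" using elim by (intro mult_mono) auto
      with elim show False by simp
    qed
    then show False by simp
  next
    case False
    let ?D = "{t. t \<le> s \<and> \<not> summable (\<lambda>n. l (Suc n) powr t)}"
    have "l (Suc n) \<noteq> 0" for n using pos[of "Suc n"] by simp
    then have "0 \<in> ?D" using s by (simp add: summable_const_iff)
    then have "?D \<noteq> {}" by blast
    with \<beta> have "\<exists>u\<in>?D. \<beta> < u"
      unfolding upper_BT_index_def by (rule less_cSupE) blast
    then obtain u where u: "\<beta> < u" "\<not> summable (\<lambda>n. l (Suc n) powr u)" by auto
    have "summable (\<lambda>n. l n powr u)"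
    proof (rule summable_comparison_test_ev)
      show "summable (\<lambda>n. real n powr - (u / \<beta>))"
        using u False by (subst summable_real_powr_iff) (simp add: field_simps)
      show "eventually (\<lambda>n. norm (l n powr u) \<le> real n powr - (u / \<beta>)) sequentially"
        using ev eventually_ge_at_top[of 1]
      proof eventually_elim
        case (elim n)
        have "l n powr \<beta> \<le> 1 / real n" using elim by (simp add: field_simps)
        then have "(l n powr \<beta>) powr (u / \<beta>) \<le> (1 / real n) powr (u / \<beta>)"
          using u False by (intro powr_mono2) auto
        also have "(l n powr \<beta>) powr (u / \<beta>) = l n powr u" using False by (simp add: powr_powr)
        also have "(1 / real n) powr (u / \<beta>) = real n powr - (u / \<beta>)"
          using elim by (simp add: powr_divide powr_minus field_simps)
        finally show ?case by simp
      qed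
    qed
    then have "summable (\<lambda>n. l (Suc n) powr u)" by (subst summable_Suc_iff)
    with u show False by simp
  qed
qed

section \<open>Category argument in the Baire space\<close>

definition cylinder :: "nat \<Rightarrow> (nat \<Rightarrow> nat) \<Rightarrow> (nat \<Rightarrow> nat) set" where
  "cylinder k x = {z. \<forall>i<k. z i = x i}"

lemma countable_cylinders: "countable {cylinder k x | k x. True}"
proof (rule countable_subset)
  have "cylinder k x = (\<lambda>xs. {z. \<forall>i<length xs. z i = xs ! i}) (map x [0..<k])" for k x
    by (simp add: cylinder_def)
  then show "{cylinder k x | k x. True} \<subseteq> range (\<lambda>xs. {z. \<forall>i<length xs. z i = xs ! i})"
    by blast
qed simp

lemma continuous_on_cylinder:
  fixes f :: "(nat \<Rightarrow> nat) \<Rightarrow> 'a::topological_space"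
  assumes f: "continuous_on UNIV f" and W: "open W" "f x \<in> W"
  shows "\<exists>k\<ge>k0. f ` cylinder k x \<subseteq> W"
proof -
  have "open (f -` W)" using f W(1) by (simp add: continuous_on_open_vimage)
  then obtain X where X: "x \<in> (\<Pi>\<^sub>E i\<in>UNIV. X i)" "finite {i. X i \<noteq> UNIV}"
      "(\<Pi>\<^sub>E i\<in>UNIV. X i) \<subseteq> f -` W"
    using product_topology_open_contains_basis[of "\<lambda>_. euclidean" UNIV "f -` W" x] W(2)
    by (auto simp: euclidean_product_topology)
  define k where "k = Suc (Max (insert k0 {i. X i \<noteq> UNIV}))"
  have k: "i < k" if "X i \<noteq> UNIV" for i
    using that X(2) by (simp add: k_def less_Suc_eq_le)
  have "k0 \<le> k" using X(2) by (simp add: k_def le_SucI)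
  moreover have "f z \<in> W" if "z \<in> cylinder k x" for z
  proof -
    have "z i \<in> X i" for i
      using k[of i] that X(1) by (cases "X i = UNIV") (auto simp: cylinder_def PiE_def Pi_def)
    then show ?thesis using X(3) by auto
  qed
  ultimately show ?thesis by blast
qed

text \<open>The Baire category theorem, carried out by hand: nested cylinders centred at points of \<open>K\<close>
  are chosen so that the image of the \<open>j\<close>-th one lies in some \<open>V n\<close> with \<open>n \<ge>
  j\<close>. They shrink to a single sequence, which need not belong to \<open>K\<close>.\<close>

lemma Baire_space_meets_limsup:
  fixes f :: "(nat \<Rightarrow> nat) \<Rightarrow> 'a::topological_space" and V :: "nat \<Rightarrow> 'a set"
  assumes f: "continuous_on UNIV f" and V: "\<And>n. open (V n)" and ne: "K \<noteq> {}"
    and hit: "\<And>x k. x \<in> K \<Longrightarrow> \<exists>\<^sub>\<infinity>n. f ` (cylinder k x \<inter> K) \<inter> V n \<noteq> {}"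
  shows "\<exists>y. \<exists>\<^sub>\<infinity>n. f y \<in> V n"
proof -
  have step: "\<exists>z k' n. z \<in> cylinder k x \<inter> K \<and> j \<le> n \<and> k0 \<le> k' \<and> f ` cylinder k' z \<subseteq> V n"
    if x: "x \<in> K" for x k k0 j
  proof -
    obtain n where "j \<le> n" "f ` (cylinder k x \<inter> K) \<inter> V n \<noteq> {}"
      using hit[OF x] unfolding INFM_nat_le by blast
    then show ?thesis using continuous_on_cylinder[OF f V] by blast
  qed
  define good where "good j S \<longleftrightarrow> (case S of (x, k, n) \<Rightarrow>
      x \<in> K \<and> j \<le> k \<and> j \<le> n \<and> f ` cylinder k x \<subseteq> V n)" for j S
  have "\<exists>S :: nat \<Rightarrow> (nat \<Rightarrow> nat) \<times> nat \<times> nat. \<forall>j. good j (S j) \<and>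
      fst (S (Suc j)) \<in> cylinder (fst (snd (S j))) (fst (S j)) \<and>
      fst (snd (S j)) \<le> fst (snd (S (Suc j)))"
  proof (rule dependent_nat_choice)
    obtain x where "x \<in> K" using ne by blast
    then show "\<exists>S. good 0 S" using step[of x 0 0 0] by (auto simp: good_def)
    fix S j assume "good j S"
    then obtain x k n where S: "S = (x, k, n)" "x \<in> K" by (auto simp: good_def)
    obtain z k' n' where "z \<in> cylinder k x \<inter> K" "Suc j \<le> n'" "max k (Suc j) \<le> k'"
        "f ` cylinder k' z \<subseteq> V n'"
      using step[OF S(2), of k "Suc j" "max k (Suc j)"] by blast
    then show "\<exists>S'. good (Suc j) S' \<and> fst S' \<in> cylinder (fst (snd S)) (fst S) \<and>
        fst (snd S) \<le> fst (snd S')"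
      by (intro exI[of _ "(z, k', n')"]) (auto simp: good_def S)
  qed
  then obtain S where S: "\<And>j. good j (S j)"
      "\<And>j. fst (S (Suc j)) \<in> cylinder (fst (snd (S j))) (fst (S j))"
      "\<And>j. fst (snd (S j)) \<le> fst (snd (S (Suc j)))" by blast
  define x where "x j = fst (S j)" for j
  define k where "k j = fst (snd (S j))" for j
  define n where "n j = snd (snd (S j))" for j
  have g: "j \<le> k j" "j \<le> n j" "f ` cylinder (k j) (x j) \<subseteq> V (n j)" for j
    using S(1)[of j] by (auto simp: good_def x_def k_def n_def split: prod.splits)
  have k_mono: "k i \<le> k j" if "i \<le> j" for i j
    using that S(3) by (auto intro: lift_Suc_mono_le simp: k_def)
  have nest: "x j \<in> cylinder (k i) (x i)" if "i \<le> j" for i j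
    using that
  proof (induction j rule: dec_induct)
    case (step j)
    then show ?case using S(2)[of j] k_mono[of i j] by (auto simp: cylinder_def x_def k_def)
  qed (simp add: cylinder_def)
  \<comment> \<open>The depth of the cylinder around the centre \<open>x j\<close> is at least \<open>j\<close>, so coordinate \<open>i\<close> is settled from stage \<open>Suc i\<close> on.\<close>
  define y where "y i = x (Suc i) i" for i
  have "y \<in> cylinder (k j) (x j)" for j
    unfolding cylinder_def
  proof safe
    fix i assume "i < k j"
    show "y i = x j i"
    proof (cases "j \<le> Suc i")
      case True
      then show ?thesis using nest[of j "Suc i"] \<open>i < k j\<close> by (simp add: cylinder_def y_def)
    next
      case False
      then show ?thesis using nest[of "Suc i" j] g(1)[of "Suc i"] by (simp add: cylinder_def y_def)
    qed
  qed
  then have "f y \<in> V (n j)" for j using g(3)[of j] by blast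
  then show ?thesis using g(2) unfolding INFM_nat_le by blast
qed

definition hausdorff_kernel ::
  "real \<Rightarrow> ((nat \<Rightarrow> nat) \<Rightarrow> 'a::metric_space) \<Rightarrow> (nat \<Rightarrow> nat) set" where
  "hausdorff_kernel t f = {x. \<forall>k. hausdorff_measure t (f ` cylinder k x) \<noteq> 0}"

text \<open>Outside the kernel, each point lies in one of countably many cylinders with null image, so cutting down to
  the kernel loses only a null set.\<close>

lemma hausdorff_kernel_cylinder_nonnull:
  assumes "hausdorff_measure t (f ` cylinder k x) \<noteq> 0"
  shows "hausdorff_measure t (f ` (cylinder k x \<inter> hausdorff_kernel t f)) \<noteq> 0"
proof
  assume null: "hausdorff_measure t (f ` (cylinder k x \<inter> hausdorff_kernel t f)) = 0"
  define \<N> where "\<N> = (`) f ` {C \<in> {cylinder k x | k x. True}. hausdorff_measure t (f ` C) = 0}"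
  have "hausdorff_measure t (f ` cylinder k x) = 0"
  proof (rule hausdorff_null_countable_Union)
    let ?\<A> = "insert (f ` (cylinder k x \<inter> hausdorff_kernel t f)) \<N>"
    have "countable \<N>"
      unfolding \<N>_def by (intro countable_image countable_subset[OF _ countable_cylinders]) auto
    then show "countable ?\<A>" by simp
    show "hausdorff_measure t A = 0" if "A \<in> ?\<A>" for A
      using that null by (auto simp: \<N>_def)
    show "f ` cylinder k x \<subseteq> \<Union>?\<A>"
    proof
      fix y assume "y \<in> f ` cylinder k x"
      then obtain z where z: "z \<in> cylinder k x" "y = f z" by blast
      show "y \<in> \<Union>?\<A>"
      proof (cases "z \<in> hausdorff_kernel t f")
        case False
        then obtain j where "hausdorff_measure t (f ` cylinder j z) = 0"
          by (auto simp: hausdorff_kernel_def)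
        then have "f ` cylinder j z \<in> \<N>" by (auto simp: \<N>_def)
        moreover have "y \<in> f ` cylinder j z" using z by (simp add: cylinder_def)
        ultimately show ?thesis by blast
      qed (use z in blast)
    qed
  qed
  with assms show False by simp
qed

section \<open>Random covering by a regular mixing process\<close>

text \<open>A gap of polynomial size \<open>r powr - \<epsilon>\<close> makes the mixing error smaller than any power
  of \<open>r\<close>.\<close>

lemma mixing_error_negligible:
  fixes C \<rho> c \<epsilon> s :: real
  assumes C: "0 < C" and \<rho>: "0 < \<rho>" "\<rho> < 1" and c: "0 < c" and \<epsilon>: "0 < \<epsilon>" and s: "0 < s"
  shows "eventually (\<lambda>r. C * \<rho> ^ nat \<lceil>r powr - \<epsilon>\<rceil> \<le> r powr s / c) (at_right 0)"
proof -
  define a where "a = - ln \<rho>"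
  have a: "0 < a" using \<rho> by (simp add: a_def)
  have "((\<lambda>r. (C * exp (- (a * r powr - \<epsilon>))) / (r powr s / c)) \<longlongrightarrow> 0) (at_right 0)"
    using a C c \<epsilon> s by real_asymp
  from order_tendstoD(2)[OF this zero_less_one]
  have "eventually (\<lambda>r. (C * exp (- (a * r powr - \<epsilon>))) / (r powr s / c) < 1) (at_right 0)" .
  then show ?thesis using eventually_at_right_less[of 0]
  proof eventually_elim
    case (elim r)
    have "\<rho> ^ nat \<lceil>r powr - \<epsilon>\<rceil> = \<rho> powr real (nat \<lceil>r powr - \<epsilon>\<rceil>)"
      using \<rho> by (intro powr_realpow[symmetric])
    also have "\<dots> \<le> \<rho> powr (r powr - \<epsilon>)"
      using \<rho> by (intro powr_mono') (auto intro: real_nat_ceiling_ge)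
    also have "\<dots> = exp (- (a * r powr - \<epsilon>))"
      using \<rho> by (simp add: powr_def a_def mult.commute)
    finally have "C * \<rho> ^ nat \<lceil>r powr - \<epsilon>\<rceil> \<le> C * exp (- (a * r powr - \<epsilon>))"
      using C by simp
    also have "\<dots> \<le> r powr s / c" using elim c by (simp add: field_simps)
    finally show ?case .
  qed
qed

locale regular_covering_process = prob_space M
  for M :: "'w measure" +
  fixes \<xi> :: "nat \<Rightarrow> 'w \<Rightarrow> 'a::metric_space" and l :: "nat \<Rightarrow> real" and s :: real
  assumes compact_space: "compact (UNIV :: 'a set)"
    and nontrivial: "\<exists>x y :: 'a. x \<noteq> y"
    and stationary: "stationary_process M \<xi>"
    and regular: "ahlfors_regular s (distr M borel (\<xi> 1))"
    and s_pos: "0 < s"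
    and l_pos: "1 \<le> n \<Longrightarrow> 0 < l n"
    and l_lim: "l \<longlonglongrightarrow> 0"
begin

lemma xi_measurable: "1 \<le> n \<Longrightarrow> \<xi> n \<in> measurable M borel"
  using stationary by (simp add: stationary_process_def)

lemma events_xi: "1 \<le> n \<Longrightarrow> S \<in> sets borel \<Longrightarrow> {\<omega> \<in> space M. \<xi> n \<omega> \<in> S} \<in> events"
  using measurable_sets[OF xi_measurable, of n S] by (simp add: vimage_def Int_def conj_commute)

lemma diameter_pos: "0 < diameter (UNIV :: 'a set)"
proof -
  obtain x y :: 'a where "x \<noteq> y" using nontrivial by blast
  then have "0 < dist x y" by simp
  also have "\<dots> \<le> diameter (UNIV :: 'a set)"
    using compact_space by (intro diameter_bounded_bound compact_imp_bounded) auto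
  finally show ?thesis .
qed

lemma ball_prob_bounds:
  obtains c where "1 \<le> c"
    "\<And>n x r. 1 \<le> n \<Longrightarrow> 0 < r \<Longrightarrow> r \<le> diameter (UNIV :: 'a set) \<Longrightarrow>
        r powr s / c \<le> prob {\<omega> \<in> space M. \<xi> n \<omega> \<in> cball x r}"
    "\<And>n x r. 1 \<le> n \<Longrightarrow> 0 < r \<Longrightarrow> r \<le> diameter (UNIV :: 'a set) \<Longrightarrow>
        prob {\<omega> \<in> space M. \<xi> n \<omega> \<in> cball x r} \<le> c * r powr s"
proof -
  have pre: "measure (distr M borel (\<xi> 1)) (cball x r) = prob {\<omega> \<in> space M. \<xi> n \<omega> \<in> cball x r}"
    if "1 \<le> n" for n x r
  proof -
    have "measure (distr M borel (\<xi> 1)) (cball x r) = prob (\<xi> 1 -` cball x r \<inter> space M)"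
      using xi_measurable[of 1] by (intro measure_distr) auto
    also have "\<xi> 1 -` cball x r \<inter> space M = {\<omega> \<in> space M. \<forall>i\<in>{1}. \<xi> i \<omega> \<in> cball x r}" by auto
    also have "prob \<dots> = prob {\<omega> \<in> space M. \<forall>i\<in>{1}. \<xi> (i + (n - 1)) \<omega> \<in> cball x r}"
      by (rule stationary_process_shift[OF stationary, symmetric]) auto
    also have "{\<omega> \<in> space M. \<forall>i\<in>{1}. \<xi> (i + (n - 1)) \<omega> \<in> cball x r} =
        {\<omega> \<in> space M. \<xi> n \<omega> \<in> cball x r}"
      using that by simp
    finally show ?thesis .
  qed
  obtain c where "1 \<le> c" and c: "\<And>x r. 0 < r \<Longrightarrow> r \<le> diameter (UNIV :: 'a set) \<Longrightarrow>
      r powr s / c \<le> measure (distr M borel (\<xi> 1)) (cball x r) \<and>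
      measure (distr M borel (\<xi> 1)) (cball x r) \<le> c * r powr s"
    using regular unfolding ahlfors_regular_def by auto
  show ?thesis
    using c by (intro that[of c]) (simp_all only: pre[symmetric] \<open>1 \<le> c\<close>)
qed

text \<open>With \<open>r = l n\<close>, the \<open>n\<close>-th ball can meet \<open>U\<close> only if its centre is
  within \<open>3 r\<close> of one of the \<open>O(r powr - t)\<close> centres of a maximal packing. These
  neighbourhoods also provide a measurable substitute for the event that the ball meets the arbitrary set
  \<open>U\<close>.\<close>

lemma AE_not_hit_of_finite_packing_premeasure:
  assumes t: "0 \<le> t" and fin: "packing_premeasure t U < \<top>"
    and summable: "summable (\<lambda>n. l (Suc n) powr (s - t))"
  shows "AE \<omega> in M. \<not> (\<exists>\<^sub>\<infinity>n. U \<inter> cball (\<xi> n \<omega>) (l n) \<noteq> {})"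
proof -
  obtain c where c: "1 \<le> c"
    "\<And>n x r. 1 \<le> n \<Longrightarrow> 0 < r \<Longrightarrow> r \<le> diameter (UNIV :: 'a set) \<Longrightarrow>
        prob {\<omega> \<in> space M. \<xi> n \<omega> \<in> cball x r} \<le> c * r powr s"
    using ball_prob_bounds by metis
  obtain \<delta> where \<delta>: "0 < \<delta>"
    "(SUP F \<in> packings \<delta> U. \<Sum>(x, r)\<in>F. ennreal ((2 * r) powr t)) < \<top>"
    using fin unfolding packing_premeasure_def INF_less_iff by auto
  then obtain K where K: "0 \<le> K"
    "(SUP F \<in> packings \<delta> U. \<Sum>(x, r)\<in>F. ennreal ((2 * r) powr t)) = ennreal K"
    by (metis less_top_ennreal)
  have count: "real (card P) * (2 * r) powr t \<le> K"
    if "0 < r" "r \<le> \<delta>" "finite P" "P \<subseteq> U" "disjoint_family_on (\<lambda>p. cball p r) P" for r P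
  proof -
    let ?F = "(\<lambda>p. (p, r)) ` P"
    have "?F \<in> packings \<delta> U"
      using that by (auto simp: packings_def disjoint_family_on_def)
    then have "(\<Sum>(x, r)\<in>?F. ennreal ((2 * r) powr t)) \<le> ennreal K"
      unfolding K(2)[symmetric] by (rule SUP_upper)
    also have "(\<Sum>(x, r)\<in>?F. ennreal ((2 * r) powr t)) = (\<Sum>x\<in>P. ennreal ((2 * r) powr t))"
      by (subst sum.reindex) (auto simp: inj_on_def)
    also have "\<dots> = ennreal (real (card P) * (2 * r) powr t)"
      by (simp add: ennreal_mult ennreal_of_nat_eq_real_of_nat)
    finally show ?thesis using K(1) by (simp add: ennreal_le_iff)
  qed
  have "\<exists>P. finite P \<and> P \<subseteq> U \<and> disjoint_family_on (\<lambda>p. cball p (l (Suc n))) P \<and>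
      U \<subseteq> (\<Union>p\<in>P. cball p (2 * l (Suc n)))" for n
    by (rule maximal_packing[OF compact_space l_pos[of "Suc n"], of U]) (simp, blast)
  then obtain P where "\<forall>n. finite (P n) \<and> P n \<subseteq> U \<and>
      disjoint_family_on (\<lambda>p. cball p (l (Suc n))) (P n) \<and>
      U \<subseteq> (\<Union>p\<in>P n. cball p (2 * l (Suc n)))"
    using choice[where Q = "\<lambda>n P. finite P \<and> P \<subseteq> U \<and>
      disjoint_family_on (\<lambda>p. cball p (l (Suc n))) P \<and> U \<subseteq> (\<Union>p\<in>P. cball p (2 * l (Suc n)))"]
    by blast
  then have P: "\<And>n. finite (P n)" "\<And>n. P n \<subseteq> U"
      "\<And>n. disjoint_family_on (\<lambda>p. cball p (l (Suc n))) (P n)"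
      "\<And>n. U \<subseteq> (\<Union>p\<in>P n. cball p (2 * l (Suc n)))"
    by blast+
  define H where "H n = (\<Union>p\<in>P n. {\<omega> \<in> space M. \<xi> (Suc n) \<omega> \<in> cball p (3 * l (Suc n))})" for n
  have H: "H n \<in> events" for n
    unfolding H_def using P(1) by (intro sets.finite_UN events_xi) auto
  have "(\<lambda>n. l (Suc n)) \<longlonglongrightarrow> 0" using l_lim by (rule LIMSEQ_Suc)
  then have small: "eventually (\<lambda>n. l (Suc n) < min \<delta> (diameter (UNIV :: 'a set) / 3)) sequentially"
    using \<delta> diameter_pos by (intro order_tendstoD(2)) auto
  have "summable (\<lambda>n. prob (H n))"
  proof (rule summable_comparison_test_ev)
    show "summable (\<lambda>n. (K * 2 powr - t * c * 3 powr s) * l (Suc n) powr (s - t))"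
      using summable by (rule summable_mult)
    show "eventually (\<lambda>n. norm (prob (H n)) \<le>
        (K * 2 powr - t * c * 3 powr s) * l (Suc n) powr (s - t)) sequentially"
      using small
    proof eventually_elim
      case (elim n)
      let ?r = "l (Suc n)"
      have r: "0 < ?r" using l_pos[of "Suc n"] by simp
      have "prob (H n) \<le> (\<Sum>p\<in>P n. prob {\<omega> \<in> space M. \<xi> (Suc n) \<omega> \<in> cball p (3 * ?r)})"
        unfolding H_def using P(1)
        by (intro finite_measure_subadditive_finite) (auto intro: events_xi simp del: mem_cball)
      also have "\<dots> \<le> (\<Sum>p\<in>P n. c * (3 * ?r) powr s)"
        using elim r by (intro sum_mono c(2)) auto
      also have "\<dots> = real (card (P n)) * (c * (3 * ?r) powr s)" by simp
      also have "\<dots> \<le> (K * (2 * ?r) powr - t) * (c * (3 * ?r) powr s)"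
      proof (rule mult_right_mono)
        have "real (card (P n)) * (2 * ?r) powr t \<le> K"
          using elim r P by (intro count) auto
        then show "real (card (P n)) \<le> K * (2 * ?r) powr - t"
          using r by (simp add: powr_minus field_simps)
      qed (use c in auto)
      also have "\<dots> = (K * 2 powr - t * c * 3 powr s) * ?r powr (s - t)"
        using r by (simp add: powr_mult powr_diff powr_minus field_simps)
      finally show ?case by simp
    qed
  qed
  then have "AE \<omega> in M. eventually (\<lambda>n. \<omega> \<in> space M - H n) sequentially"
    using H by (intro borel_cantelli_AE1) (auto simp: less_top[symmetric])
  then show ?thesis
  proof eventually_elim
    case (elim \<omega>)
    have "U \<inter> cball (\<xi> (Suc n) \<omega>) (l (Suc n)) = {}" if n: "\<omega> \<in> space M - H n" for n
    proof -
      have False if y: "y \<in> U" "y \<in> cball (\<xi> (Suc n) \<omega>) (l (Suc n))" for y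
      proof -
        obtain p where p: "p \<in> P n" "dist p y \<le> 2 * l (Suc n)" using P(4)[of n] y(1) by auto
        have "dist p (\<xi> (Suc n) \<omega>) \<le> 3 * l (Suc n)"
          using p(2) y(2) dist_triangle2[of p "\<xi> (Suc n) \<omega>" y] by (simp add: dist_commute)
        then show False using n p(1) by (auto simp: H_def)
      qed
      then show ?thesis by blast
    qed
    note * = this
    from elim have "eventually (\<lambda>n. U \<inter> cball (\<xi> (Suc n) \<omega>) (l (Suc n)) = {}) sequentially"
      by (rule eventually_mono) (rule *)
    then have "eventually (\<lambda>n. U \<inter> cball (\<xi> n \<omega>) (l n) = {}) sequentially"
      by (rule eventually_sequentially_Suc[THEN iffD1])
    then show ?case by (simp add: frequently_def cofinite_eq_sequentially)
  qed
qed

text \<open>With \<open>r = l n / 2\<close>, let \<open>J\<close> be the number of times \<open>m + 1, m + 1 + g,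
  \<dots>\<close> up to \<open>n\<close>. Since \<open>n\<close> is at least \<open>l n powr - \<beta>\<close> and
  \<open>g\<close> is about \<open>r powr - \<epsilon>\<close>, the exponent in \<open>prob_miss_le\<close> is at
  least of order \<open>r powr (- \<beta> + \<epsilon> - t + s)\<close>; the choice of \<open>\<epsilon>\<close> turns
  this into \<open>r powr - \<epsilon>\<close>, which tends to infinity. Open balls are used so that the hits persist
  under small perturbations in the category argument.\<close>

lemma AE_hits_infinitely_often:
  assumes mixing: "exponentially_mixing M \<xi>" and dec: "antimono_on {1..} l"
    and t: "0 < t" "s - upper_BT_index s l < t" and A: "hausdorff_measure t A \<noteq> 0"
  shows "AE \<omega> in M. \<exists>\<^sub>\<infinity>n. A \<inter> ball (\<xi> n \<omega>) (l n) \<noteq> {}"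
proof -
  define V where "V n = (\<Union>a\<in>A. ball a (l n))" for n
  have V: "open (V n)" for n by (auto simp: V_def)
  obtain c where c: "1 \<le> c"
    "\<And>n x r. 1 \<le> n \<Longrightarrow> 0 < r \<Longrightarrow> r \<le> diameter (UNIV :: 'a set) \<Longrightarrow>
        r powr s / c \<le> prob {\<omega> \<in> space M. \<xi> n \<omega> \<in> cball x r}"
    using ball_prob_bounds by metis
  obtain C \<rho> where mix: "0 < C" "0 < \<rho>" "\<rho> < 1"
    and mix_all: "\<forall>n\<ge>1. \<forall>x. \<forall>r>0. \<forall>D\<in>future_events M \<xi> (n + 1). prob D > 0 \<longrightarrow>
      \<bar>\<P>(\<omega> in M. \<xi> 1 \<omega> \<in> cball x r \<bar> \<omega> \<in> D) - \<P>(\<omega> in M. \<xi> 1 \<omega> \<in> cball x r)\<bar> \<le> C * \<rho> ^ n"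
    using mixing unfolding exponentially_mixing_def by (elim exE conjE)
  obtain b r0 where b: "0 < b" and r0: "0 < r0" and pack: "\<And>r. 0 < r \<Longrightarrow> r < r0 \<Longrightarrow>
    \<exists>P. finite P \<and> P \<subseteq> A \<and> disjoint_family_on (\<lambda>p. cball p r) P \<and> b * r powr - t \<le> real (card P)"
    using large_packing_if_hausdorff_nonnull[OF compact_space t(1) A] by metis
  \<comment> \<open>Midway between \<open>s - t\<close> and the index; \<open>2 * \<epsilon>\<close> is then the gain \<open>t + \<beta> - s\<close>, half of which pays for the time gaps.\<close>
  define \<beta> where "\<beta> = (s - t + upper_BT_index s l) / 2"
  define \<epsilon> where "\<epsilon> = (t + \<beta> - s) / 2"
  have \<beta>: "\<beta> < upper_BT_index s l" and \<epsilon>: "0 < \<epsilon>"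
    using t(2) by (auto simp: \<beta>_def \<epsilon>_def field_simps)
  define \<kappa> where "\<kappa> = 2 powr - \<beta> * b / (8 * c)"
  have \<kappa>: "0 < \<kappa>" using b c by (simp add: \<kappa>_def)
  define good where "good r \<longleftrightarrow> r < r0 \<and> r \<le> diameter (UNIV :: 'a set) \<and> r \<le> 1 \<and>
      C * \<rho> ^ nat \<lceil>r powr - \<epsilon>\<rceil> \<le> r powr s / (2 * c)" for r
  have half: "filterlim (\<lambda>n. l n / 2) (at_right 0) sequentially"
    unfolding filterlim_at
  proof
    show "(\<lambda>n. l n / 2) \<longlonglongrightarrow> 0" using tendsto_divide_zero[OF l_lim] .
    show "eventually (\<lambda>n. l n / 2 \<in> {0<..} \<and> l n / 2 \<noteq> 0) sequentially"
      using eventually_ge_at_top[of 1] by eventually_elim (use l_pos in force)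
  qed
  have small: "eventually (\<lambda>r. r < min r0 (min 1 (diameter (UNIV :: 'a set)))) (at_right 0)"
    using r0 diameter_pos by (intro order_tendstoD(2)[OF tendsto_ident_at]) auto
  have "eventually (\<lambda>r. C * \<rho> ^ nat \<lceil>r powr - \<epsilon>\<rceil> \<le> r powr s / (2 * c)) (at_right 0)"
    using c(1) by (intro mixing_error_negligible mix \<epsilon> s_pos) simp
  with small have "eventually good (at_right 0)"
    unfolding good_def by eventually_elim auto
  then have good_ev: "eventually (\<lambda>n. good (l n / 2)) sequentially"
    using half by (rule eventually_compose_filterlim)
  have miss_null: "prob {\<omega> \<in> space M. \<forall>n\<in>{Suc m..}. \<xi> n \<omega> \<in> - V n} = 0" (is "prob ?B = 0") for m
  proof -
    have bound: "prob ?B \<le> exp (- (\<kappa> * (l n / 2) powr - \<epsilon>))"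
      if n: "2 * Suc m \<le> n" "1 \<le> real n * l n powr \<beta>" "good (l n / 2)" for n
    proof -
      define r where "r = l n / 2"
      define g where "g = nat \<lceil>r powr - \<epsilon>\<rceil>"
      define J where "J = (n - Suc m) div g + 1"
      have r: "0 < r" "r < r0" "r \<le> diameter (UNIV :: 'a set)" "r \<le> 1"
          "C * \<rho> ^ g \<le> r powr s / (2 * c)" "l n = 2 * r"
        using n l_pos[of n] by (auto simp: good_def r_def g_def)
      have r\<epsilon>: "1 \<le> r powr - \<epsilon>" using powr_mono'[of "- \<epsilon>" 0 r] r \<epsilon> by simp
      have g: "1 \<le> g" "real g \<le> 2 * r powr - \<epsilon>"
        using r\<epsilon> by (auto simp: g_def le_nat_iff) linarith+
      obtain P where P: "finite P" "P \<subseteq> A" "disjoint_family_on (\<lambda>p. cball p r) P"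
          "b * r powr - t \<le> real (card P)"
        using pack[OF r(1,2)] by blast
      have below: "Suc m + i * g \<le> n" if "i < J" for i
      proof -
        have "i * g \<le> (n - Suc m) div g * g" using that by (simp add: J_def)
        also have "\<dots> \<le> n - Suc m" by simp
        finally show ?thesis using n(1) by simp
      qed
      have "?B \<subseteq> {\<omega> \<in> space M. \<forall>i<J. \<xi> (Suc m + i * g) \<omega> \<notin> (\<Union>p\<in>P. cball p r)}"
      proof safe
        fix \<omega> i p assume *: "\<forall>n\<in>{Suc m..}. \<xi> n \<omega> \<in> - V n" "i < J" "p \<in> P"
          "\<xi> (Suc m + i * g) \<omega> \<in> cball p r"
        \<comment> \<open>The radius at every observed time is at least \<open>2 * r\<close>, so a closed ball of radius \<open>r\<close> fits strictly inside.\<close>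
        have "l n \<le> l (Suc m + i * g)"
          using monotone_onD[OF dec, of "Suc m + i * g" n] below[OF *(2)] by auto
        then have "\<xi> (Suc m + i * g) \<omega> \<in> ball p (l (Suc m + i * g))" using *(4) r by simp
        then show False using * P(2) by (auto simp: V_def)
      qed
      moreover have "{\<omega> \<in> space M. \<forall>i<J. \<xi> (Suc m + i * g) \<omega> \<notin> (\<Union>p\<in>P. cball p r)} \<in> events"
      proof -
        define U where "U = (\<Union>p\<in>P. cball p r)"
        have "closed U" unfolding U_def using P(1) by (intro closed_UN) auto
        then have "{\<omega> \<in> space M. \<forall>i\<in>{..<J}. \<xi> (Suc m + i * g) \<omega> \<in> - U} \<in> events"
          by (intro sets.sets_Collect_finite_All events_xi borel_comp borel_closed) auto
        then show ?thesis unfolding U_def[symmetric]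
          by (simp only: Compl_iff Ball_def lessThan_iff)
      qed
      ultimately have "prob ?B \<le>
          prob {\<omega> \<in> space M. \<forall>i<J. \<xi> (Suc m + i * g) \<omega> \<notin> (\<Union>p\<in>P. cball p r)}"
        by (rule finite_measure_mono)
      also have "\<dots> \<le> exp (- (real J * (real (card P) * (r powr s / (2 * c)))))"
      proof (rule prob_miss_le[OF prob_space_axioms stationary _ P(1,3) g(1)])
        fix D p assume D: "D \<in> future_events M \<xi> (g + 1)" "prob D > 0"
        have "r powr s / c = r powr s / (2 * c) + r powr s / (2 * c)" using c(1) by (simp add: field_simps)
        moreover have "r powr s / c \<le> \<P>(\<omega> in M. \<xi> 1 \<omega> \<in> cball p r)"
          using r(1,3) by (intro c(2)) auto
        ultimately show "r powr s / (2 * c) \<le> \<P>(\<omega> in M. \<xi> 1 \<omega> \<in> cball p r \<bar> \<omega> \<in> D)"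
          using mix_all[rule_format, OF g(1) r(1) D, of p] r(5) by linarith
      qed simp
      also have "\<dots> \<le> exp (- (\<kappa> * r powr - \<epsilon>))"
      proof -
        have "n \<le> 2 * (n - Suc m)" using n(1) by arith
        then have "real n \<le> real (2 * (n - Suc m))" by (simp only: of_nat_le_iff)
        then have "real n / 2 \<le> real (n - Suc m)" by simp
        also have "\<dots> \<le> real J * real g"
        proof -
          have "n - Suc m \<le> J * g"
            using dividend_less_div_times[of g "n - Suc m"] g(1) by (simp add: J_def)
          then have "real (n - Suc m) \<le> real (J * g)" by (simp only: of_nat_le_iff)
          then show ?thesis by (simp only: of_nat_mult)
        qed
        also have "\<dots> \<le> real J * (2 * r powr - \<epsilon>)" using g(2) by (intro mult_left_mono) auto
        finally have J: "real n * r powr \<epsilon> / 4 \<le> real J"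
          using r(1) by (simp add: powr_minus field_simps)
        have "(2 * r) powr - \<beta> \<le> real n"
          using n(2) r by (simp add: powr_minus field_simps)
        then have "(2 * r) powr - \<beta> * r powr \<epsilon> / 4 \<le> real n * r powr \<epsilon> / 4"
          by (intro divide_right_mono mult_right_mono) auto
        with J have J': "(2 * r) powr - \<beta> * r powr \<epsilon> / 4 \<le> real J" by linarith
        have "\<kappa> * r powr - \<epsilon> = ((2 * r) powr - \<beta> * r powr \<epsilon> / 4) * ((b * r powr - t) * (r powr s / (2 * c)))"
        proof -
          have "- \<epsilon> = - \<beta> + \<epsilon> + - t + s" by (simp add: \<epsilon>_def field_simps)
          then have "r powr - \<epsilon> = r powr (- \<beta> + \<epsilon> + - t + s)" by (rule arg_cong)
          also have "\<dots> = r powr - \<beta> * r powr \<epsilon> * r powr - t * r powr s" by (simp only: powr_add)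
          finally have "r powr - \<epsilon> = r powr - \<beta> * r powr \<epsilon> * r powr - t * r powr s" .
          then show ?thesis using r(1) by (simp add: \<kappa>_def powr_mult)
        qed
        also have "\<dots> \<le> real J * (real (card P) * (r powr s / (2 * c)))"
          using J' P(4) b c(1) by (intro mult_mono) auto
        finally show ?thesis by simp
      qed
      finally show ?thesis by (simp add: r_def)
    qed
    have "prob ?B \<le> e" if e: "0 < e" for e
    proof -
      have "((\<lambda>r. exp (- (\<kappa> * r powr - \<epsilon>))) \<longlongrightarrow> 0) (at_right 0)"
        using \<kappa> \<epsilon> by real_asymp
      from order_tendstoD(2)[OF this e]
      have "eventually (\<lambda>n. exp (- (\<kappa> * (l n / 2) powr - \<epsilon>)) < e) sequentially"
        using half by (rule eventually_compose_filterlim)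
      with good_ev eventually_ge_at_top[of "2 * Suc m"]
      have "eventually (\<lambda>n. 1 \<le> n \<and> 1 \<le> real n * l n powr \<beta> \<longrightarrow> prob ?B \<le> e) sequentially"
        by eventually_elim (use bound in fastforce)
      moreover have "\<exists>\<^sub>F n in sequentially. 1 \<le> n \<and> 1 \<le> real n * l n powr \<beta>"
        using infinitely_many_large_radii[OF l_pos l_lim s_pos \<beta>]
        by (simp add: cofinite_eq_sequentially)
      ultimately have "\<exists>\<^sub>F n in sequentially. prob ?B \<le> e"
        by (rule frequently_rev_mp[rotated])
      then show ?thesis by simp
    qed
    then have "\<And>e. 0 < e \<Longrightarrow> prob ?B \<le> 0 + e" by (simp only: add_0)
    then have "prob ?B \<le> 0" by (rule field_le_epsilon)
    then show ?thesis by (rule antisym[OF _ measure_nonneg])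
  qed
  have "AE \<omega> in M. \<exists>n\<in>{Suc m..}. \<xi> n \<omega> \<in> V n" for m
  proof -
    have "{\<omega> \<in> space M. \<forall>n\<in>{Suc m..}. \<xi> n \<omega> \<in> - V n} \<in> events"
    proof (rule sets.sets_Collect_countable_All')
      fix n assume "n \<in> {Suc m..}"
      then show "{\<omega> \<in> space M. \<xi> n \<omega> \<in> - V n} \<in> events"
        using V by (intro events_xi borel_comp borel_open) auto
    qed simp
    then have "{\<omega> \<in> space M. \<forall>n\<in>{Suc m..}. \<xi> n \<omega> \<in> - V n} \<in> null_sets M"
      using miss_null[of m] by (simp only: null_sets_def emeasure_eq_measure mem_Collect_eq) simp
    then show ?thesis by (rule AE_I') auto
  qed
  then have "AE \<omega> in M. \<forall>m. \<exists>n\<in>{Suc m..}. \<xi> n \<omega> \<in> V n"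
    unfolding AE_all_countable by (rule allI)
  then show ?thesis
  proof eventually_elim
    case (elim \<omega>)
    show ?case unfolding INFM_nat_le
    proof
      fix m
      have "\<exists>n\<in>{Suc m..}. \<xi> n \<omega> \<in> V n" using elim by (rule spec)
      then obtain n where n: "Suc m \<le> n" "\<xi> n \<omega> \<in> V n" by (meson atLeast_iff)
      obtain a where "a \<in> A" "\<xi> n \<omega> \<in> ball a (l n)"
        using n(2) unfolding V_def by (rule UN_E)
      with n(1) show "\<exists>n\<ge>m. A \<inter> ball (\<xi> n \<omega>) (l n) \<noteq> {}"
        by (intro exI[of _ n]) (auto simp: dist_commute)
    qed
  qed
qed

lemma AE_not_hit_of_packing_dim:
  assumes dim: "packing_dim G < ereal (s - upper_BT_index s l)"
  shows "AE \<omega> in M. limsup_balls \<xi> l \<omega> \<inter> G = {}"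
proof (cases "G = {}")
  case False
  then obtain t where t: "0 \<le> t" "packing_measure t G = 0" "t < s - upper_BT_index s l"
    using dim by (auto simp: packing_dim_def Inf_less_iff)
  then have "packing_measure t G < 1" by simp
  then obtain U where U: "G \<subseteq> (\<Union>i::nat. U i)" "(\<Sum>i. packing_premeasure t (U i)) < 1"
    unfolding packing_measure_def INF_less_iff by auto
  have fin: "packing_premeasure t (U i) < \<top>" for i
    using ennreal_suminf_lessD[OF U(2), of i] by (rule less_trans) simp
  have "summable (\<lambda>n. l (Suc n) powr (s - t))"
  proof (rule ccontr)
    assume "\<not> ?thesis"
    then have "s - t \<in> {t. t \<le> s \<and> \<not> summable (\<lambda>n. l (Suc n) powr t)}" using t(1) by simp
    then have "s - t \<le> upper_BT_index s l"
      unfolding upper_BT_index_def by (rule cSup_upper) (auto intro: bdd_aboveI)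
    with t(3) show False by simp
  qed
  then have "AE \<omega> in M. \<forall>i. \<not> (\<exists>\<^sub>\<infinity>n. U i \<inter> cball (\<xi> n \<omega>) (l n) \<noteq> {})"
    unfolding AE_all_countable
    by (intro allI AE_not_hit_of_finite_packing_premeasure[OF t(1) fin])
  then show ?thesis
  proof eventually_elim
    case (elim \<omega>)
    show ?case
    proof (rule ccontr)
      assume "\<not> ?thesis"
      then obtain y where y: "\<exists>\<^sub>\<infinity>n. y \<in> cball (\<xi> n \<omega>) (l n)" "y \<in> G"
        by (auto simp: limsup_balls_def simp del: mem_cball)
      obtain i where "y \<in> U i" using U(1) y(2) by blast
      from y(1) have "\<exists>\<^sub>\<infinity>n. U i \<inter> cball (\<xi> n \<omega>) (l n) \<noteq> {}"
        by (rule frequently_elim1) (use \<open>y \<in> U i\<close> in blast)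
      with elim show False by blast
    qed
  qed
qed simp

text \<open>The exceptional null sets come from the cylinders, of which there are countably many; outside their union
  the category argument applies to each outcome separately.\<close>

lemma AE_hit_of_hausdorff_dim:
  assumes mixing: "exponentially_mixing M \<xi>" and dec: "antimono_on {1..} l"
    and index: "upper_BT_index s l < s"
    and G: "analytic_set G" and dim: "ereal (s - upper_BT_index s l) < hausdorff_dim G"
  shows "AE \<omega> in M. limsup_balls \<xi> l \<omega> \<inter> G \<noteq> {}"
proof -
  have "G \<noteq> {}" using dim by (auto simp: hausdorff_dim_def)
  then obtain f :: "(nat \<Rightarrow> nat) \<Rightarrow> 'a" where f: "continuous_on UNIV f" "range f = G"
    using G by (auto simp: analytic_set_def)
  obtain t where t: "s - upper_BT_index s l < t" "ereal t < hausdorff_dim G"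
    using ereal_dense2[OF dim] by auto
  have t0: "0 < t" using t(1) index by simp
  have nonnull: "hausdorff_measure t G \<noteq> 0"
  proof
    assume "hausdorff_measure t G = 0"
    then have "hausdorff_dim G \<le> ereal t"
      using t0 \<open>G \<noteq> {}\<close> unfolding hausdorff_dim_def by (auto intro!: Inf_lower)
    with t(2) show False by simp
  qed
  define K where "K = hausdorff_kernel t f"
  have cyl: "hausdorff_measure t (f ` (cylinder k x \<inter> K)) \<noteq> 0" if "x \<in> K" for k x
    using that hausdorff_kernel_cylinder_nonnull[of t f k x] by (simp add: K_def hausdorff_kernel_def)
  have "K \<noteq> {}"
  proof
    assume "K = {}"
    moreover have "cylinder 0 (\<lambda>_. 0) = UNIV" by (simp add: cylinder_def)
    ultimately show False
      using hausdorff_kernel_cylinder_nonnull[of t f 0 "\<lambda>_. 0"] nonnull f(2)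
      by (simp add: K_def hausdorff_measure_empty)
  qed
  let ?\<C> = "{C \<in> {cylinder k x | k x. True}. hausdorff_measure t (f ` (C \<inter> K)) \<noteq> 0}"
  have "AE \<omega> in M. \<forall>C\<in>?\<C>. \<exists>\<^sub>\<infinity>n. f ` (C \<inter> K) \<inter> ball (\<xi> n \<omega>) (l n) \<noteq> {}"
  proof (rule AE_ball_countable')
    show "countable ?\<C>" by (rule countable_subset[OF _ countable_cylinders]) auto
    show "AE \<omega> in M. \<exists>\<^sub>\<infinity>n. f ` (C \<inter> K) \<inter> ball (\<xi> n \<omega>) (l n) \<noteq> {}" if "C \<in> ?\<C>" for C
      using that t t0 by (intro AE_hits_infinitely_often[OF mixing dec, of t]) auto
  qed
  then show ?thesis
  proof eventually_elim
    case (elim \<omega>)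
    have "\<exists>y. \<exists>\<^sub>\<infinity>n. f y \<in> ball (\<xi> n \<omega>) (l n)"
    proof (rule Baire_space_meets_limsup[OF f(1) _ \<open>K \<noteq> {}\<close>])
      fix x k assume "x \<in> K"
      then have "cylinder k x \<in> ?\<C>" using cyl by blast
      then show "\<exists>\<^sub>\<infinity>n. f ` (cylinder k x \<inter> K) \<inter> ball (\<xi> n \<omega>) (l n) \<noteq> {}"
        using elim by blast
    qed simp
    then obtain y where "\<exists>\<^sub>\<infinity>n. f y \<in> ball (\<xi> n \<omega>) (l n)" by blast
    then have "\<exists>\<^sub>\<infinity>n. f y \<in> cball (\<xi> n \<omega>) (l n)"
      by (rule frequently_elim1) auto
    then have "f y \<in> limsup_balls \<xi> l \<omega>" by (simp add: limsup_balls_def)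
    moreover have "f y \<in> G" using f(2) by blast
    ultimately show ?case by blast
  qed
qed

end

section \<open>Passage to the completion\<close>

lemma sets_completion_measure_0_of_AE:
  assumes "prob_space M" "AE \<omega> in M. \<not> P \<omega>"
  shows "{\<omega> \<in> space M. P \<omega>} \<in> sets (completion M)"
    "measure (completion M) {\<omega> \<in> space M. P \<omega>} = 0"
proof -
  interpret prob_space "completion M" using assms(1) by (rule prob_space.prob_space_completion)
  show "{\<omega> \<in> space M. P \<omega>} \<in> sets (completion M)"
    using sets_completion_AE[OF assms(2)] by (simp add: pred_def)
  show "measure (completion M) {\<omega> \<in> space M. P \<omega>} = 0"
    using prob_eq_0_AE[OF AE_completion[OF assms(2)]] by simp
qed

lemma sets_completion_measure_1_of_AE:
  assumes "prob_space M" "AE \<omega> in M. P \<omega>"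
  shows "{\<omega> \<in> space M. P \<omega>} \<in> sets (completion M)"
    "measure (completion M) {\<omega> \<in> space M. P \<omega>} = 1"
proof -
  interpret prob_space "completion M" using assms(1) by (rule prob_space.prob_space_completion)
  have N: "{\<omega> \<in> space M. \<not> P \<omega>} \<in> events" "prob {\<omega> \<in> space M. \<not> P \<omega>} = 0"
    using sets_completion_measure_0_of_AE[OF assms(1), of "\<lambda>\<omega>. \<not> P \<omega>"] assms(2) by auto
  have "{\<omega> \<in> space M. P \<omega>} = space (completion M) - {\<omega> \<in> space M. \<not> P \<omega>}" by auto
  then show "{\<omega> \<in> space M. P \<omega>} \<in> events" "prob {\<omega> \<in> space M. P \<omega>} = 1"
    using N prob_compl[OF N(1)] by (simp_all only: sets.compl_sets)
qed

section \<open>Hitting probabilities of analytic sets\<close>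

theorem theorem2p1:
  fixes M :: "'w measure"
    and \<xi> :: "nat \<Rightarrow> 'w \<Rightarrow> 'a::metric_space"
    and \<mu> :: "'a measure"
    and l :: "nat \<Rightarrow> real"
    and s \<alpha> :: real
    and G :: "'a set"
  assumes "compact (UNIV :: 'a set)"
    and "\<exists>x y :: 'a. x \<noteq> y"
    and "prob_space M"
    and "stationary_process M \<xi>"
    and "exponentially_mixing M \<xi>"
    and "\<mu> = distr M borel (\<xi> 1)"
    and "0 < s"
    and "ahlfors_regular s \<mu>"
    and "\<And>n. n \<ge> 1 \<Longrightarrow> 0 < l n"
    and "antimono_on {1..} l"
    and "l \<longlonglongrightarrow> 0"
    and "\<alpha> = upper_BT_index s l"
    and "\<alpha> < s"
    and "analytic_set G"
  shows "(packing_dim G < ereal (s - \<alpha>) \<longrightarrow>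
            hitting_event M \<xi> l G \<in> sets (completion M) \<and>
            measure (completion M) (hitting_event M \<xi> l G) = 0) \<and>
         (hausdorff_dim G > ereal (s - \<alpha>) \<longrightarrow>
            hitting_event M \<xi> l G \<in> sets (completion M) \<and>
            measure (completion M) (hitting_event M \<xi> l G) = 1)"
proof -
  interpret regular_covering_process M \<xi> l s
    using assms by (simp add: regular_covering_process_def regular_covering_process_axioms_def)
  show ?thesis
    unfolding hitting_event_def
    using AE_not_hit_of_packing_dim[of G] AE_hit_of_hausdorff_dim[of G] assms
      sets_completion_measure_0_of_AE[OF assms(3), of "\<lambda>\<omega>. limsup_balls \<xi> l \<omega> \<inter> G \<noteq> {}"]
      sets_completion_measure_1_of_AE[OF assms(3), of "\<lambda>\<omega>. limsup_balls \<xi> l \<omega> \<inter> G \<noteq> {}"]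
    by simp
qed

end
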